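(* Let $Y$ and $Z$ be real Banach spaces, $\Omega$ a nonempty open subset of $Z$, $k\in\mathbb N$, and let $M$ be a nonempty bounded subset of $\mathcal{BC}^k(\Omega,Y)$ which is extendedly $k$-equicontinuous. Then $$\alpha(M)=\mu_{\overline\alpha}(M).$$
   Context: Differentiability is in the Fréchet sense. $\mathcal C^k(\Omega,Y)$ is the space of $k$-times continuously differentiable functions $f:\Omega\to Y$; for $p=0,\dots,k$, $d^pf:\Omega\to W_p$ is the differential of order $p$, where $W_p=\mathcal L(Z^p,Y)$ is the Banach space of bounded $p$-linear operators with the operator norm $\|\cdot\|_{on}$ ($W_0=Y$, $d^0f=f$). $\mathcal{BC}^k(\Omega,Y)$ is the Banach space of all $f\in\mathcal C^k(\Omega,Y)$ which are bounded together with all differentials up to order $k$, with norm $\|f\|_{\mathcal{BC}^k}=\max\{\|f\|_\infty,\|df\|_\infty,\dots,\|d^kf\|_\infty\}$, $\|d^pf\|_\infty=\sup_{x\in\Omega}\|d^pf(x)\|_{on}$. For a nonempty bounded subset of a Banach space, the Kuratowski measure of noncompactness is the infimum of all $\varepsilon>0$ such that the set can be covered by finitely many sets of diameter not greater than $\varepsilon$. $\alpha(M)$ denotes the Kuratowski measure of $M$ in $\mathcal{BC}^k(\Omega,Y)$ and $\alpha_p$ the Kuratowski measure in $W_p$. For $x\in\Omega$, $M^p(x)=\{d^pf(x):f\in M\}\subseteq W_p$, and $\mu_{\overline\alpha}(M)=\max_{0\le p\le k}\ \sup_{x\in\Omega}\alpha_p(M^p(x))$. $M$ is extendedly $k$-equicontinuous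 if $\omega_{\mathcal{BC}^k}(M)=0$, where $\omega_{\mathcal{BC}^k}(M)$ is the infimum of all $\varepsilon>0$ for which there are a finite partition $\{A_1,\dots,A_n\}$ of $\Omega$ and a finite set $\{\varphi_1,\dots,\varphi_m\}\subseteq\mathcal{BC}^k(\Omega,Y)$ such that for every $f\in M$ there is $j\in\{1,\dots,m\}$ with $\max_{0\le p\le k}\operatorname{diam}_{W_p}\big((d^p(f-\varphi_j))(A_i)\big)\le\varepsilon$ for all $i=1,\dots,n$. *)

theory Defs
  imports "HOL-Analysis.Analysis"
begin

text \<open>
  The spaces of bounded \<open>p\<close>-linear operators for \<open>p = 0, 1, 2, \<dots>\<close> have different types when they
  are built by iterating \<^typ>\<open>'z \<Rightarrow>\<^sub>L 'y\<close>. To let \<open>p\<close> be a term, all of them are embedded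
  isometrically into one normed space: a \<open>p\<close>-linear operator is a function on argument lists that
  vanishes on all lists of length different from \<open>p\<close>. The type \<open>('z, 'y) mop\<close> is the bounded
  (\<open>l\<^sup>\<infinity>\<close>) direct sum of these spaces over all \<open>p\<close>, and \<open>W p\<close> below is its \<open>p\<close>-th summand.
  On \<open>W p\<close> the norm of the type is the usual operator norm, so that the library notions of
  derivative, continuity, boundedness and diameter, used with \<open>mop\<close>, are those of \<open>W p\<close>.
\<close>

definition multilinear :: "('z::real_vector list \<Rightarrow> 'y::real_vector) \<Rightarrow> bool" where
  "multilinear A \<longleftrightarrow> (\<forall>hs. \<forall>i<length hs. linear (\<lambda>h. A (hs[i := h])))"

definition unit_lists :: "'z::real_normed_vector list set" where
  "unit_lists = {hs. \<forall>h\<in>set hs. norm h \<le> 1}"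

lemma Nil_unit_lists [simp]: "[] \<in> unit_lists"
  by (simp add: unit_lists_def)

lemma unit_lists_ne [simp]: "unit_lists \<noteq> {}"
  using Nil_unit_lists by blast

typedef (overloaded) ('z, 'y) mop =
  "{A :: 'z::real_normed_vector list \<Rightarrow> 'y::real_normed_vector.
      multilinear A \<and> bounded (A ` unit_lists)}"
  morphisms mop_apply Mop
proof
  show "(\<lambda>_. 0) \<in> {A. multilinear A \<and> bounded (A ` unit_lists)}"
    by (auto simp: multilinear_def linear_iff image_constant_conv)
qed

setup_lifting type_definition_mop

lemma multilinear_Cons:
  assumes "multilinear A"
  shows "linear (\<lambda>h. A (h # hs))" and "multilinear (\<lambda>t. A (h # t))"
proof -
  show "linear (\<lambda>h. A (h # hs))"
    using assms[unfolded multilinear_def, rule_format, of 0 "0 # hs"] by simp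
  show "multilinear (\<lambda>t. A (h # t))"
    unfolding multilinear_def
  proof (intro allI impI)
    fix hs :: "'a list" and i assume "i < length hs"
    then show "linear (\<lambda>x. A (h # hs[i := x]))"
      using assms[unfolded multilinear_def, rule_format, of "Suc i" "h # hs"] by simp
  qed
qed

lemma multilinear_norm_le:
  fixes A :: "'z::real_normed_vector list \<Rightarrow> 'y::real_normed_vector"
  assumes "multilinear A" and "\<And>hs. hs \<in> unit_lists \<Longrightarrow> norm (A hs) \<le> K"
  shows "norm (A hs) \<le> K * prod_list (map norm hs)"
  using assms
proof (induction hs arbitrary: A)
  case Nil
  then show ?case by simp
next
  case (Cons h t)
  let ?u = "sgn h"
  have u: "norm ?u \<le> 1" by (simp add: norm_sgn)
  have "norm (A (?u # t)) \<le> K * prod_list (map norm t)"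
    by (rule Cons.IH[OF multilinear_Cons(2)[OF Cons.prems(1)]])
       (use u in \<open>auto intro!: Cons.prems(2) simp: unit_lists_def\<close>)
  then have *: "norm h * norm (A (?u # t)) \<le> norm h * (K * prod_list (map norm t))"
    by (rule mult_left_mono) simp
  have "norm h *\<^sub>R ?u = h" by (cases "h = 0") (simp_all add: sgn_div_norm)
  then have "A (h # t) = norm h *\<^sub>R A (?u # t)"
    using linear_cmul[OF multilinear_Cons(1)[OF Cons.prems(1), of t], of "norm h" ?u] by simp
  with * show ?case by (simp add: mult_ac)
qed

instantiation mop :: (real_normed_vector, real_normed_vector) real_normed_vector
begin

lift_definition zero_mop :: "('a, 'b) mop" is "\<lambda>_. 0"
  by (auto simp: multilinear_def linear_iff image_constant_conv)

lift_definition plus_mop :: "('a, 'b) mop \<Rightarrow> ('a, 'b) mop \<Rightarrow> ('a, 'b) mop"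
  is "\<lambda>A B hs. A hs + B hs"
  by (auto simp: multilinear_def intro: linear_compose_add bounded_plus_comp)

lift_definition minus_mop :: "('a, 'b) mop \<Rightarrow> ('a, 'b) mop \<Rightarrow> ('a, 'b) mop"
  is "\<lambda>A B hs. A hs - B hs"
  by (auto simp: multilinear_def intro: linear_compose_sub bounded_minus_comp)

lift_definition uminus_mop :: "('a, 'b) mop \<Rightarrow> ('a, 'b) mop"
  is "\<lambda>A hs. - A hs"
  by (auto simp: multilinear_def bounded_iff intro: linear_compose_neg)

lift_definition scaleR_mop :: "real \<Rightarrow> ('a, 'b) mop \<Rightarrow> ('a, 'b) mop"
  is "\<lambda>r A hs. r *\<^sub>R A hs"
  by (auto simp: multilinear_def intro: linear_compose_scale_right bounded_scaleR_comp)

lift_definition norm_mop :: "('a, 'b) mop \<Rightarrow> real"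
  is "\<lambda>A. SUP hs\<in>unit_lists. norm (A hs)" .

definition "sgn (A :: ('a, 'b) mop) = inverse (norm A) *\<^sub>R A"

definition "dist (A :: ('a, 'b) mop) B = norm (A - B)"

definition "(uniformity :: (('a, 'b) mop \<times> ('a, 'b) mop) filter) =
  (INF e\<in>{0 <..}. principal {(x, y). dist x y < e})"

definition "open (S :: ('a, 'b) mop set) \<longleftrightarrow>
  (\<forall>x\<in>S. \<forall>\<^sub>F (x', y) in uniformity. x' = x \<longrightarrow> y \<in> S)"

lemma bdd_above_mop:
  "bdd_above ((\<lambda>hs. norm (mop_apply (A :: ('a, 'b) mop) hs)) ` unit_lists)"
  using mop_apply[of A] by (auto simp: bounded_iff bdd_above_def)

lemma norm_mop_upper:
  "hs \<in> unit_lists \<Longrightarrow> norm (mop_apply (A :: ('a, 'b) mop) hs) \<le> norm A"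
  unfolding norm_mop.rep_eq by (rule cSUP_upper[OF _ bdd_above_mop])

lemma norm_mop_least:
  "(\<And>hs. hs \<in> unit_lists \<Longrightarrow> norm (mop_apply (A :: ('a, 'b) mop) hs) \<le> c) \<Longrightarrow> norm A \<le> c"
  unfolding norm_mop.rep_eq by (rule cSUP_least) auto

lemma norm_mop_apply:
  "norm (mop_apply (A :: ('a, 'b) mop) hs) \<le> norm A * prod_list (map norm hs)"
  using mop_apply[of A] by (intro multilinear_norm_le norm_mop_upper) auto

instance
proof
  fix A B C :: "('a, 'b) mop" and r s :: real
  show "(A + B) + C = A + (B + C)" "A + B = B + A" "0 + A = A" "- A + A = 0" "A - B = A + - B"
    by (transfer, simp add: algebra_simps)+
  show "r *\<^sub>R (A + B) = r *\<^sub>R A + r *\<^sub>R B" "(r + s) *\<^sub>R A = r *\<^sub>R A + s *\<^sub>R A"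
    "r *\<^sub>R s *\<^sub>R A = (r * s) *\<^sub>R A" "1 *\<^sub>R A = A"
    by (transfer, simp add: algebra_simps)+
  show "dist A B = norm (A - B)" "sgn A = inverse (norm A) *\<^sub>R A"
    by (simp_all add: dist_mop_def sgn_mop_def)
  show "(uniformity :: (('a, 'b) mop \<times> ('a, 'b) mop) filter) =
      (INF e\<in>{0 <..}. principal {(x, y). dist x y < e})"
    by (fact uniformity_mop_def)
  show "open U \<longleftrightarrow> (\<forall>x\<in>U. \<forall>\<^sub>F (x', y) in uniformity. x' = x \<longrightarrow> y \<in> U)"
    for U :: "('a, 'b) mop set"
    by (fact open_mop_def)
  show "norm A = 0 \<longleftrightarrow> A = 0"
  proof
    assume "norm A = 0"
    then have "mop_apply A hs = 0" for hs
      using norm_mop_apply[of A hs] by simp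
    then show "A = 0"
      by (simp add: mop_apply_inject[symmetric] zero_mop.rep_eq fun_eq_iff)
  next
    assume "A = 0"
    then show "norm A = 0"
      by (simp add: norm_mop.rep_eq zero_mop.rep_eq)
  qed
  show "norm (A + B) \<le> norm A + norm B"
    by (rule norm_mop_least)
       (auto simp: plus_mop.rep_eq intro!: norm_triangle_mono norm_mop_upper)
  have le: "norm (r *\<^sub>R A) \<le> \<bar>r\<bar> * norm A" for r and A :: "('a, 'b) mop"
    by (rule norm_mop_least) (auto simp: scaleR_mop.rep_eq intro!: mult_left_mono norm_mop_upper)
  show "norm (r *\<^sub>R A) = \<bar>r\<bar> * norm A"
  proof (cases "r = 0")
    case True
    then show ?thesis by (simp add: norm_mop.rep_eq scaleR_mop.rep_eq)
  next
    case False
    have "inverse r *\<^sub>R r *\<^sub>R A = A"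
      using False by transfer simp
    then have "norm A \<le> \<bar>inverse r\<bar> * norm (r *\<^sub>R A)"
      using le[of "inverse r" "r *\<^sub>R A"] by simp
    then have "\<bar>r\<bar> * norm A \<le> norm (r *\<^sub>R A)"
      using False by (simp add: field_simps)
    with le[of r A] show ?thesis by simp
  qed
qed

end

definition W :: "nat \<Rightarrow> ('z::real_normed_vector, 'y::real_normed_vector) mop set" where
  "W p = {A. \<forall>hs. length hs \<noteq> p \<longrightarrow> mop_apply A hs = 0}"

lift_definition mop_const :: "'y::real_normed_vector \<Rightarrow> ('z::real_normed_vector, 'y) mop"
  is "\<lambda>y hs. if hs = [] then y else 0"
  by (auto simp: multilinear_def linear_iff bounded_iff)

text \<open>
  The identification of bounded linear maps \<open>T\<close> from \<open>Z\<close> to \<open>W p\<close> with elements of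
  \<open>W (p + 1)\<close>: \<open>(h, h\<^sub>1, \<dots>, h\<^sub>p) \<mapsto> T h (h\<^sub>1, \<dots>, h\<^sub>p)\<close>.
\<close>

definition mop_uncurry ::
  "('z \<Rightarrow> ('z, 'y) mop) \<Rightarrow> ('z::real_normed_vector, 'y::real_normed_vector) mop" where
  "mop_uncurry T = Mop (\<lambda>hs. case hs of [] \<Rightarrow> 0 | h # t \<Rightarrow> mop_apply (T h) t)"

text \<open>
  \<^term>\<open>Mop\<close> is only specified on bounded multilinear functions; for bounded linear \<open>T\<close> the argument
  above is one, and the identification is isometric.
\<close>

lemma mop_apply_uncurry:
  assumes "bounded_linear T"
  shows "mop_apply (mop_uncurry T) = (\<lambda>hs. case hs of [] \<Rightarrow> 0 | h # t \<Rightarrow> mop_apply (T h) t)"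
  unfolding mop_uncurry_def
proof (rule Mop_inverse, intro CollectI conjI)
  interpret T: bounded_linear T by fact
  let ?A = "\<lambda>hs. case hs of [] \<Rightarrow> 0 | h # t \<Rightarrow> mop_apply (T h) t"
  show "multilinear ?A"
    unfolding multilinear_def
  proof (intro allI impI)
    fix hs :: "'a list" and i assume i: "i < length hs"
    then obtain h t where hs: "hs = h # t" by (cases hs) auto
    show "linear (\<lambda>x. ?A (hs[i := x]))"
    proof (cases i)
      case 0
      then show ?thesis
        by (simp add: hs linear_iff T.add T.scale plus_mop.rep_eq scaleR_mop.rep_eq)
    next
      case (Suc j)
      then show ?thesis
        using mop_apply[of "T h"] i by (simp add: hs multilinear_def)
    qed
  qed
  have "norm (?A hs) \<le> onorm T" if hs: "hs \<in> unit_lists" for hs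
  proof (cases hs)
    case Nil
    then show ?thesis by (simp add: onorm_pos_le[OF assms])
  next
    case (Cons h t)
    with hs have h: "norm h \<le> 1" and t: "t \<in> unit_lists" by (auto simp: unit_lists_def)
    have "norm (mop_apply (T h) t) \<le> norm (T h)" by (rule norm_mop_upper[OF t])
    also have "\<dots> \<le> onorm T * norm h" by (rule onorm[OF assms])
    also have "\<dots> \<le> onorm T" using h onorm_pos_le[OF assms] by (simp add: mult_left_le)
    finally show ?thesis by (simp add: Cons)
  qed
  then show "bounded (?A ` unit_lists)" by (auto simp: bounded_iff)
qed

lemma norm_mop_uncurry:
  assumes T: "bounded_linear T"
  shows "norm (mop_uncurry T) = onorm T"
proof (rule antisym)
  show "norm (mop_uncurry T) \<le> onorm T"
  proof (rule norm_mop_least)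
    fix hs :: "'a list" assume hs: "hs \<in> unit_lists"
    show "norm (mop_apply (mop_uncurry T) hs) \<le> onorm T"
    proof (cases hs)
      case Nil
      then show ?thesis by (simp add: mop_apply_uncurry[OF T] onorm_pos_le[OF T])
    next
      case (Cons h t)
      with hs have h: "norm h \<le> 1" and t: "t \<in> unit_lists" by (auto simp: unit_lists_def)
      have "norm (mop_apply (T h) t) \<le> norm (T h)" by (rule norm_mop_upper[OF t])
      also have "\<dots> \<le> onorm T * norm h" by (rule onorm[OF T])
      also have "\<dots> \<le> onorm T" using h onorm_pos_le[OF T] by (simp add: mult_left_le)
      finally show ?thesis by (simp add: Cons mop_apply_uncurry[OF T])
    qed
  qed
  show "onorm T \<le> norm (mop_uncurry T)"
  proof (rule onorm_bound)
    fix h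
    show "norm (T h) \<le> norm (mop_uncurry T) * norm h"
    proof (rule norm_mop_least)
      fix t :: "'a list" assume t: "t \<in> unit_lists"
      have "prod_list (map norm t) \<le> 1"
        using t by (induction t) (auto simp: unit_lists_def intro!: mult_le_one prod_list_nonneg)
      then have "norm (mop_uncurry T) * (norm h * prod_list (map norm t))
          \<le> norm (mop_uncurry T) * norm h"
        by (intro mult_left_mono) (auto simp: mult_left_le)
      then show "norm (mop_apply (T h) t) \<le> norm (mop_uncurry T) * norm h"
        using norm_mop_apply[of "mop_uncurry T" "h # t"] by (simp add: mop_apply_uncurry[OF T])
    qed
  qed simp
qed

text \<open>
  \<open>differential p f x\<close> is meaningful at a point around which \<open>f\<close> is \<open>p - 1\<close> times differentiable
  and at which its differential of order \<open>p - 1\<close> is differentiable. On an open set it depends on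
  the values of \<open>f\<close> on that set only.
\<close>

primrec differential ::
  "nat \<Rightarrow> ('z::real_normed_vector \<Rightarrow> 'y::real_normed_vector) \<Rightarrow> 'z \<Rightarrow> ('z, 'y) mop" where
  "differential 0 f = (\<lambda>x. mop_const (f x))"
| "differential (Suc p) f = (\<lambda>x. mop_uncurry (frechet_derivative (differential p f) (at x)))"

text \<open>
  A function from \<open>\<Omega>\<close> to \<open>Y\<close> is represented by its extension by zero. No regularity is required at
  points outside \<open>\<Omega>\<close>, so this is a mere normalisation, which makes equality of elements of
  \<open>C_space\<close> the equality of functions on \<open>\<Omega>\<close>.
\<close>

definition C_space ::
  "nat \<Rightarrow> 'z::real_normed_vector set \<Rightarrow> ('z \<Rightarrow> 'y::real_normed_vector) set" where
  "C_space k \<Omega> = {f. (\<forall>x. x \<notin> \<Omega> \<longrightarrow> f x = 0) \<and>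
     (\<forall>p<k. \<forall>x\<in>\<Omega>. differential p f differentiable (at x)) \<and>
     continuous_on \<Omega> (differential k f)}"

definition BC_space ::
  "nat \<Rightarrow> 'z::real_normed_vector set \<Rightarrow> ('z \<Rightarrow> 'y::real_normed_vector) set" where
  "BC_space k \<Omega> = {f \<in> C_space k \<Omega>. \<forall>p\<le>k. bounded (differential p f ` \<Omega>)}"

definition BC_norm ::
  "nat \<Rightarrow> 'z::real_normed_vector set \<Rightarrow> ('z \<Rightarrow> 'y::real_normed_vector) \<Rightarrow> real" where
  "BC_norm k \<Omega> f = (MAX p\<in>{..k}. SUP x\<in>\<Omega>. norm (differential p f x))"

definition BC_dist ::
  "nat \<Rightarrow> 'z::real_normed_vector set \<Rightarrow> ('z \<Rightarrow> 'y::real_normed_vector) \<Rightarrow> ('z \<Rightarrow> 'y) \<Rightarrow> real" where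
  "BC_dist k \<Omega> f g = BC_norm k \<Omega> (\<lambda>x. f x - g x)"

definition BC_bounded ::
  "nat \<Rightarrow> 'z::real_normed_vector set \<Rightarrow> ('z \<Rightarrow> 'y::real_normed_vector) set \<Rightarrow> bool" where
  "BC_bounded k \<Omega> M \<longleftrightarrow> (\<exists>c. \<forall>f\<in>M. BC_norm k \<Omega> f \<le> c)"

text \<open>
  The Kuratowski measure of noncompactness of a bounded subset \<open>S\<close> of the metric space with carrier
  \<open>X\<close> and distance \<open>d\<close>. The condition \<open>diam T \<le> e\<close> is written out, since \<^term>\<open>BC_space k \<Omega>\<close>
  is not a type and since real-valued suprema are meaningless for unbounded \<open>T\<close>.
\<close>

definition kuratowski :: "'a set \<Rightarrow> ('a \<Rightarrow> 'a \<Rightarrow> real) \<Rightarrow> 'a set \<Rightarrow> real" where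
  "kuratowski X d S = Inf {e. 0 < e \<and>
     (\<exists>\<C>. finite \<C> \<and> \<C> \<subseteq> Pow X \<and> S \<subseteq> \<Union>\<C> \<and> (\<forall>T\<in>\<C>. \<forall>x\<in>T. \<forall>y\<in>T. d x y \<le> e))}"

definition mu_alpha ::
  "nat \<Rightarrow> 'z::real_normed_vector set \<Rightarrow> ('z \<Rightarrow> 'y::real_normed_vector) set \<Rightarrow> real" where
  "mu_alpha k \<Omega> M =
     (MAX p\<in>{..k}. SUP x\<in>\<Omega>. kuratowski (W p) dist ((\<lambda>f. differential p f x) ` M))"

text \<open>
  All diameters in the following definition are those of bounded sets, because \<open>f - \<phi>\<close> lies in
  \<^term>\<open>BC_space k \<Omega>\<close> for \<open>f \<in> M\<close>. For bounded \<open>M\<close> the infimum is over a nonempty set (take the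
  partition \<open>{\<Omega>}\<close> and \<open>\<phi> = 0\<close>).
\<close>

definition BC_omega ::
  "nat \<Rightarrow> 'z::real_normed_vector set \<Rightarrow> ('z \<Rightarrow> 'y::real_normed_vector) set \<Rightarrow> real" where
  "BC_omega k \<Omega> M = Inf {e. 0 < e \<and>
     (\<exists>\<A> \<Phi>. finite \<A> \<and> partition_on \<Omega> \<A> \<and> finite \<Phi> \<and> \<Phi> \<subseteq> BC_space k \<Omega> \<and>
       (\<forall>f\<in>M. \<exists>\<phi>\<in>\<Phi>. \<forall>A\<in>\<A>.
         (MAX p\<in>{..k}. diameter (differential p (\<lambda>x. f x - \<phi> x) ` A)) \<le> e))}"

definition extendedly_equicontinuous ::
  "nat \<Rightarrow> 'z::real_normed_vector set \<Rightarrow> ('z \<Rightarrow> 'y::real_normed_vector) set \<Rightarrow> bool" where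
  "extendedly_equicontinuous k \<Omega> M \<longleftrightarrow> BC_omega k \<Omega> M = 0"

end

theory Submission
  imports Defs
begin

text \<open>
  Evaluation at a point \<open>x\<close> turns a cover of \<open>M\<close> into covers of the sets \<open>M\<^sup>p(x)\<close>, which gives
  \<open>\<mu> \<le> \<alpha>\<close>. Conversely, fix a partition \<open>A\<^sub>1, \<dots>, A\<^sub>n\<close> and functions \<open>\<phi>\<^sub>j\<close> that witness extended
  equicontinuity up to \<open>e\<close>, and points \<open>x\<^sub>i \<in> A\<^sub>i\<close>. Sort \<open>f \<in> M\<close> by an index \<open>j\<close> that suits \<open>f\<close> and by
  the members of finite covers of the sets \<open>M\<^sup>p(x\<^sub>i)\<close>, of diameter at most \<open>\<mu> + e\<close>, that contain
  \<open>d\<^sup>pf(x\<^sub>i)\<close>. There are finitely many classes, and for \<open>f\<close>, \<open>g\<close> in the same class and \<open>x \<in> A\<^sub>i\<close>,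
  moving from \<open>x\<close> to \<open>x\<^sub>i\<close> changes \<open>d\<^sup>p(f - \<phi>\<^sub>j)\<close> and \<open>d\<^sup>p(g - \<phi>\<^sub>j)\<close> by at most \<open>e\<close>, so that
  \<open>\<parallel>d\<^sup>p(f - g)(x)\<parallel> \<le> \<mu> + 3e\<close>.
\<close>

section \<open>Covers by sets of small diameter\<close>

text \<open>The condition under the infimum in \<open>kuratowski\<close>, kept apart from
  \<open>0 < e\<close> so that covers can be transported without handling infima.\<close>

definition finitely_coverable :: "'a set \<Rightarrow> ('a \<Rightarrow> 'a \<Rightarrow> real) \<Rightarrow> 'a set \<Rightarrow> real \<Rightarrow> bool" where
  "finitely_coverable X d S e \<longleftrightarrow>
     (\<exists>\<C>. finite \<C> \<and> \<C> \<subseteq> Pow X \<and> S \<subseteq> \<Union>\<C> \<and> (\<forall>T\<in>\<C>. \<forall>x\<in>T. \<forall>y\<in>T. d x y \<le> e))"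

lemma kuratowski_eq_Inf: "kuratowski X d S = Inf {e. 0 < e \<and> finitely_coverable X d S e}"
  by (simp add: kuratowski_def finitely_coverable_def)

lemma finitely_coverable_mono:
  "finitely_coverable X d S e \<Longrightarrow> e \<le> e' \<Longrightarrow> finitely_coverable X d S e'"
  unfolding finitely_coverable_def by (meson order_trans)

lemma kuratowski_le:
  assumes "finitely_coverable X d S e" and "0 < e"
  shows "kuratowski X d S \<le> e"
  unfolding kuratowski_eq_Inf
  by (rule cInf_lower) (use assms in \<open>auto intro: bdd_belowI[of _ 0]\<close>)

text \<open>The witness \<open>e0\<close> makes the set under \<open>Inf\<close> nonempty. The
  infimum of the empty set is unspecified, so a strict bound alone would yield no cover.\<close>

lemma finitely_coverable_if_kuratowski_less:
  assumes "kuratowski X d S < e" and "finitely_coverable X d S e0" and "0 < e0"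
  shows "finitely_coverable X d S e"
proof -
  have "{e. 0 < e \<and> finitely_coverable X d S e} \<noteq> {}"
    using assms(2,3) by blast
  from cInf_lessD[OF this assms(1)[unfolded kuratowski_eq_Inf]]
  obtain e' where "finitely_coverable X d S e'" "e' < e"
    by blast
  then show ?thesis
    by (simp add: finitely_coverable_mono)
qed

text \<open>The fibres of \<open>\<sigma>\<close> on \<open>S\<close> form the cover, so covering
  reduces to sorting \<open>S\<close> into finitely many classes.\<close>

lemma finitely_coverable_by_classes:
  assumes "S \<subseteq> X" and "finite (\<sigma> ` S)"
    and "\<And>x y. x \<in> S \<Longrightarrow> y \<in> S \<Longrightarrow> \<sigma> x = \<sigma> y \<Longrightarrow> d x y \<le> e"
  shows "finitely_coverable X d S e"
  unfolding finitely_coverable_def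
  by (rule exI[of _ "(\<lambda>s. {x \<in> S. \<sigma> x = s}) ` \<sigma> ` S"]) (use assms in auto)

text \<open>The images of the members of a cover form a cover. The map is nonexpansive on all of
  \<open>X\<close>, since these members may leave \<open>S\<close>.\<close>

lemma finitely_coverable_image:
  assumes "finitely_coverable X d S e" and "h ` X \<subseteq> X'"
    and "\<And>x y. x \<in> X \<Longrightarrow> y \<in> X \<Longrightarrow> d' (h x) (h y) \<le> d x y"
  shows "finitely_coverable X' d' (h ` S) e"
proof -
  obtain \<C> where C: "finite \<C>" "\<C> \<subseteq> Pow X" "S \<subseteq> \<Union>\<C>"
      "\<forall>T\<in>\<C>. \<forall>x\<in>T. \<forall>y\<in>T. d x y \<le> e"
    using assms(1) unfolding finitely_coverable_def by (elim exE conjE)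
  show ?thesis
    unfolding finitely_coverable_def
  proof (rule exI[of _ "(`) h ` \<C>"], intro conjI)
    show "finite ((`) h ` \<C>)"
      using C(1) by simp
    show "(`) h ` \<C> \<subseteq> Pow X'"
    proof clarify
      fix T x assume "T \<in> \<C>" "x \<in> T"
      then have "x \<in> X" using C(2) by auto
      then show "h x \<in> X'" using assms(2) by auto
    qed
    show "h ` S \<subseteq> \<Union>((`) h ` \<C>)"
      using C(3) by (simp add: image_Union[symmetric] image_mono)
    show "\<forall>T\<in>(`) h ` \<C>. \<forall>x\<in>T. \<forall>y\<in>T. d' x y \<le> e"
    proof clarify
      fix T x y assume "T \<in> \<C>" "x \<in> T" "y \<in> T"
      then have "x \<in> X" "y \<in> X" "d x y \<le> e"
        using C(2,4) by auto
      with assms(3)[of x y] show "d' (h x) (h y) \<le> e"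
        by linarith
    qed
  qed
qed

section \<open>Differentials\<close>

text \<open>Lets evaluation at a fixed argument list pass through a derivative; this serves
  \<open>differential_in_W\<close>.\<close>

lemma bounded_linear_mop_apply:
  "bounded_linear (\<lambda>A :: ('z::real_normed_vector, 'y::real_normed_vector) mop. mop_apply A hs)"
  by (rule bounded_linear_intro[where K = "prod_list (map norm hs)"])
     (auto simp: plus_mop.rep_eq scaleR_mop.rep_eq norm_mop_apply)

lemma mop_uncurry_diff:
  assumes "bounded_linear S" and "bounded_linear T"
  shows "mop_uncurry (\<lambda>h. S h - T h) = mop_uncurry S - mop_uncurry T"
  using assms
  by (simp add: mop_apply_inject[symmetric] mop_apply_uncurry bounded_linear_sub minus_mop.rep_eq
      fun_eq_iff split: list.split)

lemma mop_uncurry_zero: "mop_uncurry (\<lambda>h. 0) = 0"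
  by (simp add: mop_apply_inject[symmetric] mop_apply_uncurry zero_mop.rep_eq fun_eq_iff
      split: list.split)

lemma differential_zero: "differential p (\<lambda>x. 0) = (\<lambda>x. 0)"
proof (induction p)
  case 0
  show ?case
    by (simp add: fun_eq_iff mop_apply_inject[symmetric] mop_const.rep_eq zero_mop.rep_eq)
next
  case (Suc p)
  then show ?case
    by (simp add: mop_uncurry_zero)
qed

lemma zero_in_BC_space: "(\<lambda>x. 0) \<in> BC_space k \<Omega>"
  by (simp add: BC_space_def C_space_def differential_zero image_constant_conv)

lemma differential_has_derivative:
  assumes "f \<in> C_space k \<Omega>" and "p < k" and "x \<in> \<Omega>"
  shows "(differential p f has_derivative frechet_derivative (differential p f) (at x)) (at x)"
  using assms by (simp add: C_space_def frechet_derivative_works)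

text \<open>Induction on the order: since \<Omega> is open, the identity for order \<open>p\<close>
  holds near \<open>x\<close>, so both of its sides have the same derivative there.\<close>

lemma differential_diff:
  fixes f g :: "'z::real_normed_vector \<Rightarrow> 'y::real_normed_vector"
  assumes "open \<Omega>" and f: "f \<in> C_space k \<Omega>" and g: "g \<in> C_space k \<Omega>"
    and "p \<le> k" and "x \<in> \<Omega>"
  shows "differential p (\<lambda>x. f x - g x) x = differential p f x - differential p g x"
  using assms(4,5)
proof (induction p arbitrary: x)
  case 0
  show ?case
    by (auto simp: mop_apply_inject[symmetric] mop_const.rep_eq minus_mop.rep_eq fun_eq_iff)
next
  case (Suc p)
  let ?F = "frechet_derivative (differential p f) (at x)"
  let ?G = "frechet_derivative (differential p g) (at x)"
  have F: "(differential p f has_derivative ?F) (at x)"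
    and G: "(differential p g has_derivative ?G) (at x)"
    using Suc.prems f g by (auto intro: differential_has_derivative)
  have "(differential p (\<lambda>x. f x - g x) has_derivative (\<lambda>h. ?F h - ?G h)) (at x)"
    by (rule has_derivative_transform_within_open[OF has_derivative_diff[OF F G] assms(1)])
       (use Suc in auto)
  then have "frechet_derivative (differential p (\<lambda>x. f x - g x)) (at x) = (\<lambda>h. ?F h - ?G h)"
    by (rule frechet_derivative_at[symmetric])
  then show ?case
    using F G by (simp add: mop_uncurry_diff has_derivative_bounded_linear)
qed

text \<open>The covers in \<open>kuratowski (W p)\<close> consist of subsets of \<open>W p\<close>.
  For a list \<open>t\<close> of wrong length, evaluation at \<open>t\<close> of the previous
  differential is constantly 0 near \<open>x\<close>, so its derivative is 0 by uniqueness.\<close>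

lemma differential_in_W:
  fixes f :: "'z::real_normed_vector \<Rightarrow> 'y::real_normed_vector"
  assumes "open \<Omega>" and f: "f \<in> C_space k \<Omega>" and "p \<le> k" and "x \<in> \<Omega>"
  shows "differential p f x \<in> W p"
  using assms(3,4)
proof (induction p arbitrary: x)
  case 0
  show ?case
    by (simp add: W_def mop_const.rep_eq)
next
  case (Suc p)
  let ?F = "frechet_derivative (differential p f) (at x)"
  have F: "(differential p f has_derivative ?F) (at x)"
    using Suc.prems f by (auto intro: differential_has_derivative)
  have "mop_apply (?F h) t = 0" if "length t \<noteq> p" for h t
  proof -
    have "((\<lambda>u. mop_apply (differential p f u) t) has_derivative (\<lambda>h. mop_apply (?F h) t)) (at x)"
      by (rule bounded_linear.has_derivative[OF bounded_linear_mop_apply F])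
    moreover have "((\<lambda>u. mop_apply (differential p f u) t) has_derivative (\<lambda>h. 0)) (at x)"
      by (rule has_derivative_transform_within_open[OF has_derivative_const assms(1)])
         (use Suc that in \<open>auto simp: W_def\<close>)
    ultimately have "(\<lambda>h. mop_apply (?F h) t) = (\<lambda>h. 0)"
      by (rule has_derivative_unique)
    from fun_cong[OF this, of h] show ?thesis
      by simp
  qed
  \<comment> \<open>Uncurrying adds one argument, and the default value 0 at \<open>[]\<close> fits,
    as \<open>[]\<close> never has length \<open>Suc p\<close>.\<close>
  then show ?case
    by (auto simp: W_def mop_apply_uncurry[OF has_derivative_bounded_linear[OF F]] split: list.split)
qed

section \<open>The norm of the space of bounded functions\<close>

text \<open>Boundedness enters because a real \<open>SUP\<close> is known to dominate its members
  only for a family bounded above.\<close>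

lemma norm_differential_le_BC_norm:
  assumes "bounded (differential p f ` \<Omega>)" and "p \<le> k" and "x \<in> \<Omega>"
  shows "norm (differential p f x) \<le> BC_norm k \<Omega> f"
proof -
  have "bdd_above ((\<lambda>x. norm (differential p f x)) ` \<Omega>)"
    using assms(1) by (auto simp: bounded_iff bdd_above_def)
  then have "norm (differential p f x) \<le> (SUP x\<in>\<Omega>. norm (differential p f x))"
    using assms(3) by (rule cSUP_upper2) simp
  also have "\<dots> \<le> BC_norm k \<Omega> f"
    unfolding BC_norm_def using assms(2) by (intro Max_ge) auto
  finally show ?thesis .
qed

lemma BC_norm_le:
  assumes "\<Omega> \<noteq> {}" and "\<And>p x. p \<le> k \<Longrightarrow> x \<in> \<Omega> \<Longrightarrow> norm (differential p f x) \<le> c"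
  shows "BC_norm k \<Omega> f \<le> c"
  unfolding BC_norm_def using assms by (auto intro!: cSUP_least)

lemma BC_space_subset_C_space: "BC_space k \<Omega> \<subseteq> C_space k \<Omega>"
  by (auto simp: BC_space_def)

text \<open>Supplies the boundedness under which the suprema in \<open>BC_norm\<close> and
  \<open>diameter\<close> control the differentials of a difference.\<close>

lemma bounded_differential_diff:
  assumes "open \<Omega>" and f: "f \<in> BC_space k \<Omega>" and g: "g \<in> BC_space k \<Omega>" and "p \<le> k"
  shows "bounded (differential p (\<lambda>x. f x - g x) ` \<Omega>)"
proof -
  have "bounded ((\<lambda>x. differential p f x - differential p g x) ` \<Omega>)"
    using f g \<open>p \<le> k\<close> by (intro bounded_minus_comp) (auto simp: BC_space_def)
  moreover have "f \<in> C_space k \<Omega>" "g \<in> C_space k \<Omega>"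
    using f g BC_space_subset_C_space by blast+
  ultimately show ?thesis
    using assms(1,4) by (simp add: differential_diff cong: image_cong)
qed

text \<open>With \<open>BC_dist_le\<close>, this characterises \<open>BC_dist\<close> as the least
  upper bound of the pointwise distances of differentials; only these two facts about it are used
  below.\<close>

lemma dist_differential_le_BC_dist:
  assumes "open \<Omega>" and f: "f \<in> BC_space k \<Omega>" and g: "g \<in> BC_space k \<Omega>"
    and "p \<le> k" and "x \<in> \<Omega>"
  shows "dist (differential p f x) (differential p g x) \<le> BC_dist k \<Omega> f g"
proof -
  have "f \<in> C_space k \<Omega>" "g \<in> C_space k \<Omega>"
    using f g BC_space_subset_C_space by blast+
  then have "dist (differential p f x) (differential p g x)
      = norm (differential p (\<lambda>x. f x - g x) x)"
    using assms by (simp add: differential_diff dist_norm)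
  also have "\<dots> \<le> BC_dist k \<Omega> f g"
    unfolding BC_dist_def
    by (rule norm_differential_le_BC_norm[OF bounded_differential_diff[OF assms(1-4)] assms(4,5)])
  finally show ?thesis .
qed

lemma BC_dist_le:
  assumes "open \<Omega>" and "\<Omega> \<noteq> {}" and "f \<in> BC_space k \<Omega>" and "g \<in> BC_space k \<Omega>"
    and "\<And>p x. p \<le> k \<Longrightarrow> x \<in> \<Omega> \<Longrightarrow> dist (differential p f x) (differential p g x) \<le> c"
  shows "BC_dist k \<Omega> f g \<le> c"
proof -
  have "f \<in> C_space k \<Omega>" "g \<in> C_space k \<Omega>"
    using assms BC_space_subset_C_space by blast+
  then show ?thesis
    unfolding BC_dist_def using assms by (intro BC_norm_le) (auto simp: differential_diff dist_norm)
qed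

section \<open>The two inequalities\<close>

lemma BC_bounded_differentials:
  assumes "M \<subseteq> BC_space k \<Omega>" and "BC_bounded k \<Omega> M"
  obtains c where "0 < c"
    and "\<And>f p x. f \<in> M \<Longrightarrow> p \<le> k \<Longrightarrow> x \<in> \<Omega> \<Longrightarrow> norm (differential p f x) \<le> c"
proof -
  obtain c where c: "\<And>f. f \<in> M \<Longrightarrow> BC_norm k \<Omega> f \<le> c"
    using assms(2) by (auto simp: BC_bounded_def)
  \<comment> \<open>\<open>BC_bounded\<close> says nothing about the sign of \<open>c\<close>; the
    new constant is positive.\<close>
  have "norm (differential p f x) \<le> \<bar>c\<bar> + 1" if "f \<in> M" "p \<le> k" "x \<in> \<Omega>" for f p x
  proof -
    have "bounded (differential p f ` \<Omega>)"
      using assms(1) that by (auto simp: BC_space_def)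
    from norm_differential_le_BC_norm[OF this that(2,3)] c[OF that(1)] show ?thesis
      by linarith
  qed
  then show thesis
    by (intro that[of "\<bar>c\<bar> + 1"]) auto
qed

text \<open>Makes the infimum for \<alpha>(M) range over a nonempty set: a constant classifier gives
  the cover by \<open>M\<close> alone, of diameter at most twice a common bound of the
  differentials.\<close>

lemma BC_bounded_finitely_coverable:
  assumes "open \<Omega>" and "\<Omega> \<noteq> {}" and M: "M \<subseteq> BC_space k \<Omega>" and "BC_bounded k \<Omega> M"
  obtains e where "0 < e" and "finitely_coverable (BC_space k \<Omega>) (BC_dist k \<Omega>) M e"
proof -
  obtain c where c: "0 < c"
      "\<And>f p x. f \<in> M \<Longrightarrow> p \<le> k \<Longrightarrow> x \<in> \<Omega> \<Longrightarrow> norm (differential p f x) \<le> c"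
    by (rule BC_bounded_differentials[OF assms(3,4)]) blast
  have "BC_dist k \<Omega> f g \<le> c + c" if "f \<in> M" "g \<in> M" for f g
  proof (rule BC_dist_le)
    show "dist (differential p f x) (differential p g x) \<le> c + c" if "p \<le> k" "x \<in> \<Omega>" for p x
      unfolding dist_norm using that \<open>f \<in> M\<close> \<open>g \<in> M\<close> by (intro norm_triangle_le_diff add_mono c(2))
  qed (use assms that in auto)
  then have "finitely_coverable (BC_space k \<Omega>) (BC_dist k \<Omega>) M (c + c)"
    by (intro finitely_coverable_by_classes[OF M, where \<sigma> = "\<lambda>_. ()"])
       (auto simp: finite_subset[of _ "{()}"])
  with c(1) show thesis
    by (intro that[of "c + c"]) auto
qed

section \<open>Evaluation at a point: \<mu> \<le> \<alpha>\<close>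

lemma finitely_coverable_values:
  assumes "open \<Omega>" and "p \<le> k" and "x \<in> \<Omega>"
    and "finitely_coverable (BC_space k \<Omega>) (BC_dist k \<Omega>) M e"
  shows "finitely_coverable (W p) dist ((\<lambda>f. differential p f x) ` M) e"
proof (rule finitely_coverable_image[OF assms(4)])
  show "(\<lambda>f. differential p f x) ` BC_space k \<Omega> \<subseteq> W p"
    using differential_in_W[OF assms(1) _ assms(2,3)] BC_space_subset_C_space by blast
qed (rule dist_differential_le_BC_dist[OF assms(1) _ _ assms(2,3)])

lemma kuratowski_values_le:
  assumes "open \<Omega>" and "\<Omega> \<noteq> {}" and "M \<subseteq> BC_space k \<Omega>" and "BC_bounded k \<Omega> M"
    and "p \<le> k" and "x \<in> \<Omega>"
  shows "kuratowski (W p) dist ((\<lambda>f. differential p f x) ` M)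
    \<le> kuratowski (BC_space k \<Omega>) (BC_dist k \<Omega>) M"
proof -
  obtain e0 where "0 < e0" "finitely_coverable (BC_space k \<Omega>) (BC_dist k \<Omega>) M e0"
    using BC_bounded_finitely_coverable[OF assms(1-4)] by blast
  then have "{e. 0 < e \<and> finitely_coverable (BC_space k \<Omega>) (BC_dist k \<Omega>) M e} \<noteq> {}"
    by blast
  then show ?thesis
    unfolding kuratowski_eq_Inf[of "BC_space k \<Omega>"]
  proof (rule cInf_greatest)
    fix e assume "e \<in> {e. 0 < e \<and> finitely_coverable (BC_space k \<Omega>) (BC_dist k \<Omega>) M e}"
    then show "kuratowski (W p) dist ((\<lambda>f. differential p f x) ` M) \<le> e"
      by (intro kuratowski_le finitely_coverable_values[OF assms(1,5,6)]) simp_all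
  qed
qed

text \<open>The \<open>SUP\<close> over \<open>x\<close> has to be bounded above; \<alpha>(M) is the
  common bound, so the easy inequality also serves the converse one.\<close>

lemma kuratowski_values_le_mu_alpha:
  assumes "open \<Omega>" and "\<Omega> \<noteq> {}" and "M \<subseteq> BC_space k \<Omega>" and "BC_bounded k \<Omega> M"
    and "p \<le> k" and "x \<in> \<Omega>"
  shows "kuratowski (W p) dist ((\<lambda>f. differential p f x) ` M) \<le> mu_alpha k \<Omega> M"
proof -
  have "bdd_above ((\<lambda>x. kuratowski (W p) dist ((\<lambda>f. differential p f x) ` M)) ` \<Omega>)"
    by (rule bdd_aboveI2) (rule kuratowski_values_le[OF assms(1-5)])
  then have "kuratowski (W p) dist ((\<lambda>f. differential p f x) ` M)
      \<le> (SUP x\<in>\<Omega>. kuratowski (W p) dist ((\<lambda>f. differential p f x) ` M))"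
    using assms(6) by (rule cSUP_upper2) simp
  also have "\<dots> \<le> mu_alpha k \<Omega> M"
    unfolding mu_alpha_def using assms(5) by (intro Max_ge) auto
  finally show ?thesis .
qed

lemma mu_alpha_le_kuratowski:
  assumes "open \<Omega>" and "\<Omega> \<noteq> {}" and "M \<subseteq> BC_space k \<Omega>" and "BC_bounded k \<Omega> M"
  shows "mu_alpha k \<Omega> M \<le> kuratowski (BC_space k \<Omega>) (BC_dist k \<Omega>) M"
proof -
  have "(SUP x\<in>\<Omega>. kuratowski (W p) dist ((\<lambda>f. differential p f x) ` M))
      \<le> kuratowski (BC_space k \<Omega>) (BC_dist k \<Omega>) M" if "p \<le> k" for p
    by (rule cSUP_least[OF assms(2)]) (rule kuratowski_values_le[OF assms that])
  then show ?thesis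
    unfolding mu_alpha_def by (intro Max.boundedI) auto
qed

section \<open>Equicontinuity: \<alpha> \<le> \<mu>\<close>

text \<open>A vanishing infimum over a nonempty set has members below any \<open>e > 0\<close>; the
  diameters are then unfolded into pointwise distances.\<close>

lemma extendedly_equicontinuousE:
  fixes \<Omega> :: "'z::real_normed_vector set" and M :: "('z \<Rightarrow> 'y::real_normed_vector) set"
  assumes "open \<Omega>" and "\<Omega> \<noteq> {}" and M: "M \<subseteq> BC_space k \<Omega>" and "BC_bounded k \<Omega> M"
    and "extendedly_equicontinuous k \<Omega> M" and "0 < e"
  obtains \<A> \<Phi> where "finite \<A>" and "partition_on \<Omega> \<A>" and "finite \<Phi>" and "\<Phi> \<subseteq> BC_space k \<Omega>"
    and "\<And>f. f \<in> M \<Longrightarrow> \<exists>\<phi>\<in>\<Phi>. \<forall>A\<in>\<A>. \<forall>p\<le>k. \<forall>x\<in>A. \<forall>y\<in>A.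
      dist (differential p f x - differential p \<phi> x) (differential p f y - differential p \<phi> y) \<le> e"
proof -
  define E where "E = {e. 0 < e \<and>
     (\<exists>\<A> \<Phi>. finite \<A> \<and> partition_on \<Omega> \<A> \<and> finite \<Phi> \<and> \<Phi> \<subseteq> BC_space k \<Omega> \<and>
       (\<forall>f\<in>M. \<exists>\<phi>\<in>\<Phi>. \<forall>A\<in>\<A>.
         (MAX p\<in>{..k}. diameter (differential p (\<lambda>x. f x - \<phi> x) ` A)) \<le> e))}"
  obtain c where c: "0 < c"
      "\<And>f p x. f \<in> M \<Longrightarrow> p \<le> k \<Longrightarrow> x \<in> \<Omega> \<Longrightarrow> norm (differential p f x) \<le> c"
    by (rule BC_bounded_differentials[OF assms(3,4)]) blast
  have "(MAX p\<in>{..k}. diameter (differential p f ` \<Omega>)) \<le> c + c" if "f \<in> M" for f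
  proof -
    have "diameter (differential p f ` \<Omega>) \<le> c + c" if "p \<le> k" for p
    proof (rule diameter_le)
      show "norm (u - v) \<le> c + c"
        if "u \<in> differential p f ` \<Omega>" "v \<in> differential p f ` \<Omega>" for u v
      proof (intro norm_triangle_le_diff add_mono)
        show "norm u \<le> c" "norm v \<le> c"
          using that c(2)[OF \<open>f \<in> M\<close> \<open>p \<le> k\<close>] by auto
      qed
    qed (use assms(2) in simp)
    then show ?thesis by auto
  qed
  \<comment> \<open>The partition into \<Omega> alone and the zero function show that
    \<open>E\<close> is nonempty, which \<open>cInf_lessD\<close> requires.\<close>
  then have "c + c \<in> E"
    unfolding E_def using c(1) assms(2)
    by (intro CollectI conjI exI[of _ "{\<Omega>}"] exI[of _ "{\<lambda>x. 0}"])
       (auto simp: partition_on_def zero_in_BC_space)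
  moreover have "Inf E = 0"
    using assms(5) by (simp add: extendedly_equicontinuous_def BC_omega_def E_def)
  ultimately obtain e' where "e' \<in> E" "e' < e"
    using cInf_lessD[of E e] \<open>0 < e\<close> by auto
  then obtain \<A> \<Phi> where fin: "finite \<A>" "finite \<Phi>"
    and part: "partition_on \<Omega> \<A>" and Phi: "\<Phi> \<subseteq> BC_space k \<Omega>"
    and diam: "\<And>f. f \<in> M \<Longrightarrow> \<exists>\<phi>\<in>\<Phi>. \<forall>A\<in>\<A>.
         (MAX p\<in>{..k}. diameter (differential p (\<lambda>x. f x - \<phi> x) ` A)) \<le> e'"
    unfolding E_def by blast
  have "\<exists>\<phi>\<in>\<Phi>. \<forall>A\<in>\<A>. \<forall>p\<le>k. \<forall>x\<in>A. \<forall>y\<in>A.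
      dist (differential p f x - differential p \<phi> x) (differential p f y - differential p \<phi> y) \<le> e"
    if f: "f \<in> M" for f
  proof -
    obtain \<phi> where \<phi>: "\<phi> \<in> \<Phi>"
      "\<And>A. A \<in> \<A> \<Longrightarrow> (MAX p\<in>{..k}. diameter (differential p (\<lambda>x. f x - \<phi> x) ` A)) \<le> e'"
      using diam[OF f] by blast
    have BC: "f \<in> BC_space k \<Omega>" "\<phi> \<in> BC_space k \<Omega>"
      using f \<phi>(1) M Phi by auto
    then have C: "f \<in> C_space k \<Omega>" "\<phi> \<in> C_space k \<Omega>"
      using BC_space_subset_C_space by blast+
    show ?thesis
    proof (intro bexI[OF _ \<phi>(1)] ballI allI impI)
      fix A p x y assume A: "A \<in> \<A>" and p: "p \<le> k" and xy: "x \<in> A" "y \<in> A"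
      let ?D = "differential p (\<lambda>x. f x - \<phi> x)"
      have sub: "A \<subseteq> \<Omega>" using part A by (auto simp: partition_on_def)
      \<comment> \<open>\<open>diameter\<close> is a real supremum, so boundedness of the image is
        what makes it dominate distances.\<close>
      then have "bounded (?D ` A)"
        using bounded_subset[OF bounded_differential_diff[OF assms(1) BC p]] by blast
      then have "dist (?D x) (?D y) \<le> diameter (?D ` A)"
        using xy by (intro diameter_bounded_bound) auto
      also have "\<dots> \<le> (MAX p\<in>{..k}. diameter (differential p (\<lambda>x. f x - \<phi> x) ` A))"
        using p by (intro Max_ge) auto
      also have "\<dots> \<le> e" using \<phi>(2)[OF A] \<open>e' < e\<close> by linarith
      finally have "dist (?D x) (?D y) \<le> e" .
      moreover have "x \<in> \<Omega>" "y \<in> \<Omega>" using sub xy by auto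
      ultimately show "dist (differential p f x - differential p \<phi> x)
          (differential p f y - differential p \<phi> y) \<le> e"
        using differential_diff[OF assms(1) C p] by simp
    qed
  qed
  then show thesis
    using fin part Phi by (intro that) auto
qed

lemma finitely_coverable_mu_alpha:
  fixes \<Omega> :: "'z::real_normed_vector set" and M :: "('z \<Rightarrow> 'y::real_normed_vector) set"
  assumes "open \<Omega>" and "\<Omega> \<noteq> {}" and M: "M \<subseteq> BC_space k \<Omega>" and "BC_bounded k \<Omega> M"
    and "extendedly_equicontinuous k \<Omega> M" and "0 < e"
  shows "finitely_coverable (BC_space k \<Omega>) (BC_dist k \<Omega>) M (mu_alpha k \<Omega> M + 3 * e)"
proof -
  obtain \<A> \<Phi> where fin: "finite \<A>" "finite \<Phi>" and part: "partition_on \<Omega> \<A>"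
    and ex: "\<And>f. f \<in> M \<Longrightarrow> \<exists>\<phi>\<in>\<Phi>. \<forall>A\<in>\<A>. \<forall>p\<le>k. \<forall>x\<in>A. \<forall>y\<in>A.
      dist (differential p f x - differential p \<phi> x) (differential p f y - differential p \<phi> y) \<le> e"
    using extendedly_equicontinuousE[OF assms] by metis
  obtain \<phi> where \<phi>: "\<And>f. f \<in> M \<Longrightarrow> \<phi> f \<in> \<Phi>"
    "\<And>f A p x y. f \<in> M \<Longrightarrow> A \<in> \<A> \<Longrightarrow> p \<le> k \<Longrightarrow> x \<in> A \<Longrightarrow> y \<in> A \<Longrightarrow>
      dist (differential p f x - differential p (\<phi> f) x)
        (differential p f y - differential p (\<phi> f) y) \<le> e"
    using ex by metis
  \<comment> \<open>Cells of a partition are nonempty, so each has a sample point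
    \<open>\<xi> A\<close>.\<close>
  have "\<forall>A\<in>\<A>. \<exists>x. x \<in> A" using part unfolding partition_on_def by (metis ex_in_conv)
  then obtain \<xi> where \<xi>: "\<And>A. A \<in> \<A> \<Longrightarrow> \<xi> A \<in> A" by metis
  have sub: "A \<subseteq> \<Omega>" if "A \<in> \<A>" for A using part that by (auto simp: partition_on_def)
  obtain e0 where e0: "0 < e0" "finitely_coverable (BC_space k \<Omega>) (BC_dist k \<Omega>) M e0"
    using BC_bounded_finitely_coverable[OF assms(1-4)] by blast
  \<comment> \<open>The pairs of an order and a cell index the finitely many sets of values to be
    covered.\<close>
  define Q where "Q = {..k} \<times> \<A>"
  have "\<exists>\<C>. finite \<C> \<and> (\<lambda>f. differential (fst q) f (\<xi> (snd q))) ` M \<subseteq> \<Union>\<C> \<and>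
      (\<forall>T\<in>\<C>. \<forall>x\<in>T. \<forall>y\<in>T. dist x y \<le> mu_alpha k \<Omega> M + e)" if "q \<in> Q" for q
  proof -
    have q: "fst q \<le> k" "\<xi> (snd q) \<in> \<Omega>" using that \<xi> subsetD[OF sub] by (auto simp: Q_def)
    \<comment> \<open>The infimum need not be attained, so the cover is taken at a bound strictly
      above it; this is the first of the three \<open>e\<close>.\<close>
    have "kuratowski (W (fst q)) dist ((\<lambda>f. differential (fst q) f (\<xi> (snd q))) ` M)
        < mu_alpha k \<Omega> M + e"
      using kuratowski_values_le_mu_alpha[OF assms(1-4) q] \<open>0 < e\<close> by linarith
    then have "finitely_coverable (W (fst q)) dist
        ((\<lambda>f. differential (fst q) f (\<xi> (snd q))) ` M) (mu_alpha k \<Omega> M + e)"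
      by (rule finitely_coverable_if_kuratowski_less[OF
            _ finitely_coverable_values[OF assms(1) q e0(2)] e0(1)])
    then show ?thesis unfolding finitely_coverable_def by blast
  qed
  then obtain \<C> where \<C>: "\<And>q. q \<in> Q \<Longrightarrow> finite (\<C> q)"
    "\<And>q. q \<in> Q \<Longrightarrow> (\<lambda>f. differential (fst q) f (\<xi> (snd q))) ` M \<subseteq> \<Union>(\<C> q)"
    "\<And>q T x y. q \<in> Q \<Longrightarrow> T \<in> \<C> q \<Longrightarrow> x \<in> T \<Longrightarrow> y \<in> T \<Longrightarrow> dist x y \<le> mu_alpha k \<Omega> M + e"
    by metis
  have "\<forall>f\<in>M. \<forall>q\<in>Q. \<exists>T. T \<in> \<C> q \<and> differential (fst q) f (\<xi> (snd q)) \<in> T"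
    using \<C>(2) by blast
  then obtain \<tau> where \<tau>: "\<And>f q. f \<in> M \<Longrightarrow> q \<in> Q \<Longrightarrow> \<tau> f q \<in> \<C> q"
    "\<And>f q. f \<in> M \<Longrightarrow> q \<in> Q \<Longrightarrow> differential (fst q) f (\<xi> (snd q)) \<in> \<tau> f q"
    by metis
  \<comment> \<open>Restriction to \<open>Q\<close> puts the second component into the finite set
    \<open>PiE Q \<C>\<close>; outside \<open>Q\<close> the choice \<open>\<tau> f\<close> is
    arbitrary.\<close>
  define \<sigma> where "\<sigma> f = (\<phi> f, restrict (\<tau> f) Q)" for f
  have "\<sigma> ` M \<subseteq> \<Phi> \<times> PiE Q \<C>"
    using \<phi>(1) \<tau>(1) by (auto simp: \<sigma>_def)
  moreover have "finite (\<Phi> \<times> PiE Q \<C>)"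
    using fin \<C>(1) by (intro finite_SigmaI finite_PiE) (auto simp: Q_def)
  ultimately have "finite (\<sigma> ` M)" by (rule finite_subset)
  then show ?thesis
  proof (rule finitely_coverable_by_classes[OF M])
    fix f g assume f: "f \<in> M" and g: "g \<in> M" and eq: "\<sigma> f = \<sigma> g"
    show "BC_dist k \<Omega> f g \<le> mu_alpha k \<Omega> M + 3 * e"
    proof (rule BC_dist_le)
      fix p x assume p: "p \<le> k" and "x \<in> \<Omega>"
      then obtain A where A: "A \<in> \<A>" "x \<in> A" using part by (auto simp: partition_on_def)
      let ?y = "\<xi> A"
      have q: "(p, A) \<in> Q" using p A by (simp add: Q_def)
      have "\<phi> g = \<phi> f" "\<tau> g (p, A) = \<tau> f (p, A)"
        using eq q by (auto simp: \<sigma>_def dest: fun_cong[of _ _ "(p, A)"])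
      then have "dist (differential p f ?y) (differential p g ?y) \<le> mu_alpha k \<Omega> M + e"
        using \<C>(3)[OF q \<tau>(1)[OF f q]] \<tau>(2)[OF f q] \<tau>(2)[OF g q] by simp
      moreover have "dist (differential p f x - differential p (\<phi> f) x)
          (differential p f ?y - differential p (\<phi> f) ?y) \<le> e"
        using \<phi>(2)[OF f A(1) p A(2) \<xi>[OF A(1)]] .
      moreover have "dist (differential p g x - differential p (\<phi> f) x)
          (differential p g ?y - differential p (\<phi> f) ?y) \<le> e"
        using \<phi>(2)[OF g A(1) p A(2) \<xi>[OF A(1)]] \<open>\<phi> g = \<phi> f\<close> by simp
      \<comment> \<open>\<open>u\<close> compares \<open>f\<close> and \<open>g\<close> at the
        sample point; \<open>v\<close> and \<open>w\<close> are the changes from there to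
        \<open>x\<close> after subtracting the same \<open>\<phi> f\<close>, which cancels in
        \<open>u + v - w\<close>. They contribute the other two \<open>e\<close>.\<close>
      moreover define u v w where
        "u = differential p f ?y - differential p g ?y" and
        "v = differential p f x - differential p (\<phi> f) x
          - (differential p f ?y - differential p (\<phi> f) ?y)" and
        "w = differential p g x - differential p (\<phi> f) x
          - (differential p g ?y - differential p (\<phi> f) ?y)"
      ultimately have "norm u \<le> mu_alpha k \<Omega> M + e" "norm v \<le> e" "norm w \<le> e"
        by (simp_all only: dist_norm)
      then have "norm (u + v - w) \<le> mu_alpha k \<Omega> M + 3 * e"
        using norm_triangle_ineq4[of "u + v" w] norm_triangle_ineq[of u v] by linarith
      moreover have "differential p f x - differential p g x = u + v - w"
        by (simp add: u_def v_def w_def)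
      ultimately show "dist (differential p f x) (differential p g x) \<le> mu_alpha k \<Omega> M + 3 * e"
        by (simp add: dist_norm)
    qed (use assms f g in auto)
  qed
qed

theorem corollary4p3:
  fixes \<Omega> :: "'z::banach set" and M :: "('z \<Rightarrow> 'y::banach) set" and k :: nat
  assumes "open \<Omega>" and "\<Omega> \<noteq> {}"
    and "M \<noteq> {}" and "M \<subseteq> BC_space k \<Omega>" and "BC_bounded k \<Omega> M"
    and "extendedly_equicontinuous k \<Omega> M"
  shows "kuratowski (BC_space k \<Omega>) (BC_dist k \<Omega>) M = mu_alpha k \<Omega> M"
proof (rule antisym)
  note bdd = assms(1,2,4,5)
  obtain x where x: "x \<in> \<Omega>" using assms(2) by blast
  obtain e0 where e0: "0 < e0" "finitely_coverable (BC_space k \<Omega>) (BC_dist k \<Omega>) M e0"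
    using BC_bounded_finitely_coverable[OF bdd] by blast
  \<comment> \<open>\<open>kuratowski_le\<close> asks for a positive bound. Nonnegativity of \<mu>
    comes from order 0 at one point, where the infimum runs over a nonempty set of positive
    numbers.\<close>
  have "0 \<le> kuratowski (W 0) dist ((\<lambda>f. differential 0 f x) ` M)"
    unfolding kuratowski_eq_Inf
    using finitely_coverable_values[OF assms(1) le0 x e0(2)] e0(1)
    by (intro cInf_greatest) auto
  also have "\<dots> \<le> mu_alpha k \<Omega> M"
    by (rule kuratowski_values_le_mu_alpha[OF bdd le0 x])
  finally have mu: "0 \<le> mu_alpha k \<Omega> M" .
  show "kuratowski (BC_space k \<Omega>) (BC_dist k \<Omega>) M \<le> mu_alpha k \<Omega> M"
  proof (rule field_le_epsilon)
    fix e :: real assume "0 < e"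
    \<comment> \<open>The parameter \<open>e / 3\<close> absorbs the factor 3.\<close>
    then have "finitely_coverable (BC_space k \<Omega>) (BC_dist k \<Omega>) M (mu_alpha k \<Omega> M + 3 * (e / 3))"
      using assms by (intro finitely_coverable_mu_alpha) auto
    then show "kuratowski (BC_space k \<Omega>) (BC_dist k \<Omega>) M \<le> mu_alpha k \<Omega> M + e"
      using mu \<open>0 < e\<close> by (intro kuratowski_le) auto
  qed
  show "mu_alpha k \<Omega> M \<le> kuratowski (BC_space k \<Omega>) (BC_dist k \<Omega>) M"
    by (rule mu_alpha_le_kuratowski[OF bdd])
qed

end
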